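(* Let $G=(I,(S_i)_{i\in I},(g_i)_{i\in I})$ be a pure strategy game with $|I|<\infty$, and let $P$ be a group set of $G$. Suppose that each $S_i$ is a convex compact set in a topological vector space, each $g_i$ is continuous and partially analytic, and any sub-game (with respect to $P$) has an equilibrium. Then for any initial joint strategy $s\in\prod_{i\in I}S_i$ there exists a finite-length grouped satisficing path $(s^t)_{t=0}^{T}$ with respect to $P$ such that $s^0=s$ and $s^T$ is an equilibrium of $G$.
   Context: A pure strategy game is a tuple $G=(I,(S_i)_{i\in I},(g_i)_{i\in I})$ with $I$ a finite set of players, $S_i$ the strategy set of player $i$, and $g_i:\prod_{j\in I}S_j\to\mathbb{R}$ the payoff function of player $i$. Products carry the product topology. A joint strategy is an element $s=(s_i)_{i\in I}$ of $\prod_{i\in I}S_i$; $s_{-i}$ denotes $(s_j)_{j\ne i}$. Best response: $BR(s_{-i})=\{r\in S_i: g_i(r,s_{-i})\ge \sup_{t\in S_i}g_i(t,s_{-i})\}$. Player $i$ achieves best response in $s$ if $s_i\in BR(s_{-i})$. A joint strategy $s$ is an equilibrium if every player achieves best response in $s$. Group set: a set $P$ of pairwise disjoint subsets of $I$ with $\bigcup_{p\in P}p=I$; its elements are called groups. A group $p$ achieves best response in $s$ if every $i\in p$ does. Grouped satisficing path with respect to $P$: a sequence $(s^t)$ of joint strategies such that, for each $t$ for which $s^{t+1}$ is defined and each $p\in P$: if $s_i^t\in BR(s_{-i}^t)$ for all $i\in p$, then $s_i^{t+1}=s_i^t$ for all $i\in p$. For a path $(s^t)_{t=0}^T$ this is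 required for $0\le t<T$. Partially analytic: if each $X_i$ $(i\in I)$ is a convex set in a topological vector space, $f:\prod_{i\in I}X_i\to\mathbb{R}$ is partially analytic if for every $i\in I$, $p_i,q_i\in X_i$ and $x_{-i}\in\prod_{j\ne i}X_j$, the function $[0,1]\to\mathbb{R}$, $a\mapsto f(ap_i+(1-a)q_i,x_{-i})$ is real analytic in $a$. "Any sub-game has an equilibrium" (with respect to $P$) means: for every $Q\subset P$ and every joint strategy $s$, writing $J=\bigcup_{p\in Q}p$, the game $(J,(S_i)_{i\in J},(\tilde g_i)_{i\in J})$ with $\tilde g_i(w)=g_i(s_{-J},w)$ for $w\in\prod_{j\in J}S_j$, where $s_{-J}=(s_k)_{k\in I\setminus J}$, admits at least one equilibrium. *)

theory Defs
  imports "HOL-Analysis.Analysis"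
begin

text \<open>
  A real topological vector space is a topology whose carrier is a linear subspace of the
  ambient real vector space \<^typ>\<open>'a\<close> and for which the vector space operations are continuous.
  Since the topology is a value and not a type class instance, the players of a game may use
  different topological vector spaces. The Hausdorff axiom is not part of the definition.
\<close>

definition tvs :: "'a::real_vector topology \<Rightarrow> bool" where
  "tvs X \<longleftrightarrow>
     subspace (topspace X) \<and>
     continuous_map (prod_topology X X) X (\<lambda>(x, y). x + y) \<and>
     continuous_map (prod_topology euclideanreal X) X (\<lambda>(a, x). a *\<^sub>R x)"

text \<open>
  Power series expansions are only required to represent the function inside \<open>A\<close>. On a compact
  interval they are therefore one-sided at the end points.
\<close>

definition real_analytic_on :: "(real \<Rightarrow> real) \<Rightarrow> real set \<Rightarrow> bool" where
  "real_analytic_on f A \<longleftrightarrow>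
     (\<forall>a\<in>A. \<exists>r>0. \<exists>c :: nat \<Rightarrow> real.
        \<forall>x\<in>A. \<bar>x - a\<bar> < r \<longrightarrow> (\<lambda>n. c n * (x - a) ^ n) sums f x)"

text \<open>
  Elements of a product are extensional functions. For \<open>x\<close> in the product over \<open>I - {i}\<close>, the
  joint strategy \<open>(r, x)\<close> is the update \<open>x(i := r)\<close>.
\<close>

definition partially_analytic ::
  "'i set \<Rightarrow> ('i \<Rightarrow> 'a::real_vector set) \<Rightarrow> (('i \<Rightarrow> 'a) \<Rightarrow> real) \<Rightarrow> bool" where
  "partially_analytic I X f \<longleftrightarrow>
     (\<forall>i\<in>I. \<forall>p\<in>X i. \<forall>q\<in>X i. \<forall>x\<in>Pi\<^sub>E (I - {i}) X.
        real_analytic_on (\<lambda>a. f (x(i := a *\<^sub>R p + (1 - a) *\<^sub>R q))) {0..1})"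

text \<open>The supremum is taken in the extended reals, as the payoff need not be bounded.\<close>

definition best_response ::
  "('i \<Rightarrow> 'a set) \<Rightarrow> ('i \<Rightarrow> ('i \<Rightarrow> 'a) \<Rightarrow> real) \<Rightarrow> 'i \<Rightarrow> ('i \<Rightarrow> 'a) \<Rightarrow> 'a set" where
  "best_response S g i x =
     {r \<in> S i. ereal (g i (x(i := r))) \<ge> (SUP t\<in>S i. ereal (g i (x(i := t))))}"

definition achieves_best_response ::
  "'i set \<Rightarrow> ('i \<Rightarrow> 'a set) \<Rightarrow> ('i \<Rightarrow> ('i \<Rightarrow> 'a) \<Rightarrow> real) \<Rightarrow> ('i \<Rightarrow> 'a) \<Rightarrow> 'i \<Rightarrow> bool" where
  "achieves_best_response I S g s i \<longleftrightarrow> s i \<in> best_response S g i (restrict s (I - {i}))"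

definition equilibrium ::
  "'i set \<Rightarrow> ('i \<Rightarrow> 'a set) \<Rightarrow> ('i \<Rightarrow> ('i \<Rightarrow> 'a) \<Rightarrow> real) \<Rightarrow> ('i \<Rightarrow> 'a) \<Rightarrow> bool" where
  "equilibrium I S g s \<longleftrightarrow>
     s \<in> Pi\<^sub>E I S \<and> (\<forall>i\<in>I. achieves_best_response I S g s i)"

text \<open>In contrast to \<^const>\<open>partition_on\<close>, the empty group is allowed.\<close>

definition group_set :: "'i set \<Rightarrow> 'i set set \<Rightarrow> bool" where
  "group_set I P \<longleftrightarrow> disjoint P \<and> \<Union>P = I"

definition group_achieves_best_response ::
  "'i set \<Rightarrow> ('i \<Rightarrow> 'a set) \<Rightarrow> ('i \<Rightarrow> ('i \<Rightarrow> 'a) \<Rightarrow> real) \<Rightarrow> ('i \<Rightarrow> 'a) \<Rightarrow> 'i set \<Rightarrow> bool" where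
  "group_achieves_best_response I S g s p \<longleftrightarrow> (\<forall>i\<in>p. achieves_best_response I S g s i)"

text \<open>Only the values \<open>\<sigma> 0, \<dots>, \<sigma> T\<close> are part of the path.\<close>

definition grouped_satisficing_path ::
  "'i set \<Rightarrow> ('i \<Rightarrow> 'a set) \<Rightarrow> ('i \<Rightarrow> ('i \<Rightarrow> 'a) \<Rightarrow> real) \<Rightarrow> 'i set set \<Rightarrow> (nat \<Rightarrow> 'i \<Rightarrow> 'a) \<Rightarrow> nat \<Rightarrow> bool" where
  "grouped_satisficing_path I S g P \<sigma> T \<longleftrightarrow>
     (\<forall>t\<le>T. \<sigma> t \<in> Pi\<^sub>E I S) \<and>
     (\<forall>t<T. \<forall>p\<in>P. group_achieves_best_response I S g (\<sigma> t) p \<longrightarrow>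
        (\<forall>i\<in>p. \<sigma> (Suc t) i = \<sigma> t i))"

text \<open>
  Payoffs of the game on the players \<open>J\<close> in which all players outside of \<open>J\<close> keep playing
  according to \<open>s\<close>.
\<close>

definition subgame_payoff ::
  "'i set \<Rightarrow> ('i \<Rightarrow> ('i \<Rightarrow> 'a) \<Rightarrow> real) \<Rightarrow> ('i \<Rightarrow> 'a) \<Rightarrow> ('i \<Rightarrow> ('i \<Rightarrow> 'a) \<Rightarrow> real)" where
  "subgame_payoff J g s = (\<lambda>i w. g i (override_on s w J))"

definition any_subgame_has_equilibrium ::
  "'i set \<Rightarrow> ('i \<Rightarrow> 'a set) \<Rightarrow> ('i \<Rightarrow> ('i \<Rightarrow> 'a) \<Rightarrow> real) \<Rightarrow> 'i set set \<Rightarrow> bool" where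
  "any_subgame_has_equilibrium I S g P \<longleftrightarrow>
     (\<forall>Q\<subseteq>P. \<forall>s\<in>Pi\<^sub>E I S. \<exists>w. equilibrium (\<Union>Q) S (subgame_payoff (\<Union>Q) g s) w)"

end

theory Submission
  imports Defs "HOL-Complex_Analysis.Cauchy_Integral_Formula"
begin

text \<open>
  From \<open>s\<close>, first let the players of unsatisfied groups move such that these groups stay
  unsatisfied and a further group becomes unsatisfied, as long as this is possible. Then move these
  players to an equilibrium of their sub-game. The resulting \<open>y\<close> is an equilibrium of the whole
  game: being unsatisfied is an open condition, and arbitrarily close to \<open>y\<close> there are joint
  strategies in which all the unsatisfied groups are still unsatisfied, so a player who became
  unsatisfied in \<open>y\<close> would contradict maximality. For these close strategies, note that the
  payoff of an unsatisfied player is not constant in that player's own strategy. By analyticity this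
  persists when the coordinates are moved one after the other almost all the way to \<open>y\<close>; a
  small change of the player's own strategy then suffices to be off the best response.
\<close>

section \<open>Zeros of analytic functions on an interval\<close>

lemma real_analytic_on_diff:
  assumes "real_analytic_on f A" "real_analytic_on h A"
  shows "real_analytic_on (\<lambda>x. f x - h x) A"
  unfolding real_analytic_on_def
proof
  fix a assume "a \<in> A"
  then obtain r c where r: "r > 0" "\<forall>x\<in>A. \<bar>x - a\<bar> < r \<longrightarrow> (\<lambda>n. c n * (x - a) ^ n) sums f x"
    using assms(1) unfolding real_analytic_on_def by blast
  obtain r' c' where r': "r' > 0" "\<forall>x\<in>A. \<bar>x - a\<bar> < r' \<longrightarrow> (\<lambda>n. c' n * (x - a) ^ n) sums h x"
    using assms(2) \<open>a \<in> A\<close> unfolding real_analytic_on_def by blast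
  have "(\<lambda>n. (c n - c' n) * (x - a) ^ n) sums (f x - h x)"
    if "x \<in> A" "\<bar>x - a\<bar> < min r r'" for x
    using sums_diff[of "\<lambda>n. c n * (x - a) ^ n" "f x" "\<lambda>n. c' n * (x - a) ^ n" "h x"] r r' that
    by (simp add: left_diff_distrib)
  moreover have "min r r' > 0" using r r' by simp
  ultimately show "\<exists>r>0. \<exists>c. \<forall>x\<in>A. \<bar>x - a\<bar> < r \<longrightarrow> (\<lambda>n. c n * (x - a) ^ n) sums (f x - h x)"
    by (intro exI[of _ "min r r'"] conjI exI[of _ "\<lambda>n. c n - c' n"]) blast+
qed

lemma real_analytic_on_const: "real_analytic_on (\<lambda>_. k) A"
proof -
  have "(\<lambda>n. (if n = 0 then k else 0) * (x - a) ^ n) sums k" for x a :: real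
    by (rule sums_cong[THEN iffD2, OF _ sums_single[of 0 "\<lambda>_. k"]]) simp
  then show ?thesis unfolding real_analytic_on_def
    by (intro ballI exI[of _ 1] conjI, simp) (rule exI[of _ "\<lambda>n. if n = 0 then k else 0"], simp)
qed

text \<open>If all coefficients of the expansion at \<open>a\<close> vanish, so does
  \<open>f\<close> near \<open>a\<close>; otherwise the zeros of the power series other than
  \<open>a\<close> keep away from \<open>a\<close>.\<close>

lemma real_analytic_on_isolated_zeros:
  assumes "real_analytic_on f A" "a \<in> A"
  obtains r where "r > 0"
    "(\<forall>x\<in>A. \<bar>x - a\<bar> < r \<longrightarrow> f x = 0) \<or> (\<forall>x\<in>A. x \<noteq> a \<and> \<bar>x - a\<bar> < r \<longrightarrow> f x \<noteq> 0)"
proof -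
  obtain r c where r: "r > 0" and f: "\<And>x. x \<in> A \<Longrightarrow> \<bar>x - a\<bar> < r \<Longrightarrow> (\<lambda>n. c n * (x - a) ^ n) sums f x"
    using assms unfolding real_analytic_on_def by meson
  \<comment> \<open>If \<open>A\<close> has no second point near \<open>a\<close>, the second
    alternative is vacuous. Otherwise such a point \<open>z\<close> is a place where the series is
    known to converge.\<close>
  consider (zero) "\<And>n. c n = 0" | (isolated) "\<And>x. x \<in> A \<Longrightarrow> x \<noteq> a \<Longrightarrow> \<not> \<bar>x - a\<bar> < r"
    | (nonzero) m z where "c m \<noteq> 0" "z \<in> A" "z \<noteq> a" "\<bar>z - a\<bar> < r"
    by blast
  then show thesis
  proof cases
    case zero
    then have "f x = 0" if "x \<in> A" "\<bar>x - a\<bar> < r" for x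
      using f[OF that] sums_unique2[OF _ sums_zero] by simp
    then show thesis using r that by blast
  next
    case isolated
    then show thesis using r that by blast
  next
    case nonzero
    define b where "b = case_nat 0 c"
    define F where "F x = (x - a) * (\<Sum>n. c n * (x - a) ^ n)" for x
    \<comment> \<open>The additional factor \<open>x - a\<close> treats the cases \<open>f a = 0\<close> and \<open>f a \<noteq> 0\<close> at once.\<close>
    have F: "(\<lambda>n. b n * (x - a) ^ n) sums F x" if "norm (x - a) < \<bar>z - a\<bar>" for x
    proof -
      \<comment> \<open>Convergence at the single point \<open>z\<close> yields convergence on both
        sides of \<open>a\<close>, also where \<open>x\<close> lies outside \<open>A\<close> and the
        series need not represent \<open>f\<close>.\<close>
      have "summable (\<lambda>n. c n * (x - a) ^ n)"
        using powser_inside[of c "z - a" "x - a"] f[of z] nonzero that by (auto simp: sums_iff)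
      then have "(\<lambda>n. (x - a) * (c n * (x - a) ^ n)) sums F x"
        unfolding F_def by (intro sums_mult summable_sums)
      then have "(\<lambda>n. b (Suc n) * (x - a) ^ Suc n) sums F x"
        by (simp add: b_def mult_ac)
      then show ?thesis
        by (subst (asm) sums_Suc_iff) (simp add: b_def)
    qed
    have "F a = 0" "b (Suc m) \<noteq> 0" "\<bar>z - a\<bar> > 0" using nonzero by (auto simp: F_def b_def)
    from powser_0_nonzero[OF this(3) F this(1,2)]
    obtain u where u: "u > 0" "\<And>x. x \<in> cball a u - {a} \<Longrightarrow> F x \<noteq> 0"
      by blast
    \<comment> \<open>On \<open>A\<close> near \<open>a\<close> the series sums to
      \<open>f x\<close>, so \<open>F x = (x - a) * f x\<close>.\<close>
    have "f x \<noteq> 0" if "x \<in> A" "x \<noteq> a" "\<bar>x - a\<bar> < min u r" for x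
      using u(2)[of x] that f[of x] by (auto simp: F_def sums_iff dist_real_def abs_minus_commute)
    then show thesis using u(1) r by (intro that[of "min u r"] disjI2) auto
  qed
qed

lemma at_within_unit_interval_neq_bot: "a \<in> {0..1} \<Longrightarrow> at a within {0..1::real} \<noteq> bot"
  by (simp add: trivial_limit_within islimpt_Icc)

text \<open>This is the identity theorem: vanishing in a neighbourhood is a locally constant
  property of the point, so on the connected interval it would spread from \<open>a\<close> to
  \<open>b\<close>.\<close>

lemma real_analytic_on_eventually_nonzero:
  assumes f: "real_analytic_on f {0..1}" and ab: "a \<in> {0..1}" "b \<in> {0..1}" and "f b \<noteq> 0"
  shows "eventually (\<lambda>x. f x \<noteq> 0) (at a within {0..1})"
proof (rule ccontr)
  assume not_ev: "\<not> ?thesis"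
  define Z where "Z a \<longleftrightarrow> (\<exists>r>0. \<forall>x\<in>{0..1}. \<bar>x - a\<bar> < r \<longrightarrow> f x = 0)" for a
  \<comment> \<open>Zeros arbitrarily close to \<open>a\<close> rule out the second alternative of
    the isolated zeros lemma.\<close>
  have "Z a"
    using real_analytic_on_isolated_zeros[OF f ab(1)] not_ev
    unfolding Z_def eventually_at dist_real_def by metis
  have nontriv: "\<exists>x\<in>{0..1}. x \<noteq> u \<and> \<bar>x - u\<bar> < r" if "u \<in> {0..1}" "r > 0" for u r :: real
    using at_within_unit_interval_neq_bot[OF that(1)] that(2)
    unfolding trivial_limit_within islimpt_approachable dist_real_def by blast
  have "Z b"
  proof (rule connected_induction_simple[of "{0..1}" a b Z])
    fix u :: real assume u: "u \<in> {0..1}"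
    obtain r where r: "r > 0" and alt: "(\<forall>x\<in>{0..1}. \<bar>x - u\<bar> < r \<longrightarrow> f x = 0) \<or>
        (\<forall>x\<in>{0..1}. x \<noteq> u \<and> \<bar>x - u\<bar> < r \<longrightarrow> f x \<noteq> 0)"
      using real_analytic_on_isolated_zeros[OF f u] by blast
    have "Z y" if "x \<in> {0..1} \<inter> ball u r" "y \<in> {0..1} \<inter> ball u r" "Z x" for x y
      using alt
    proof
      assume *: "\<forall>x\<in>{0..1}. \<bar>x - u\<bar> < r \<longrightarrow> f x = 0"
      show "Z y" unfolding Z_def
        using * that(2) by (intro exI[of _ "r - \<bar>y - u\<bar>"]) (auto simp: dist_real_def)
    next
      assume *: "\<forall>x\<in>{0..1}. x \<noteq> u \<and> \<bar>x - u\<bar> < r \<longrightarrow> f x \<noteq> 0"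
      obtain q where q: "q > 0" "\<forall>y\<in>{0..1}. \<bar>y - x\<bar> < q \<longrightarrow> f y = 0"
        using \<open>Z x\<close> unfolding Z_def by blast
      \<comment> \<open>\<open>Z x\<close> gives \<open>f x = 0\<close>, which is possible only at
        \<open>u\<close>. Then \<open>f\<close> vanishes near \<open>u\<close>, against a point
        supplied by \<open>nontriv\<close>, so this case is contradictory.\<close>
      have "x = u" using * q that(1) by (force simp: dist_real_def)
      then show "Z y" using nontriv[OF u, of "min q r"] * q r by auto
    qed
    moreover have "u \<in> {0..1} \<inter> ball u r" using u r by simp
    ultimately show "\<exists>T. openin (top_of_set {0..1}) T \<and> u \<in> T \<and> (\<forall>x\<in>T. \<forall>y\<in>T. Z x \<longrightarrow> Z y)"
      using openin_open_Int[OF open_ball] by blast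
  qed (use ab \<open>Z a\<close> in auto)
  then show False using assms unfolding Z_def by force
qed

text \<open>Turns open conditions in an abstract topology into \<open>eventually\<close> statements,
  which can then be combined with the conclusions of the identity theorem.\<close>

lemma continuous_map_eventually_at:
  assumes "continuous_map (top_of_set A) X h" "openin X U" "h a \<in> U" "a \<in> A"
  shows "eventually (\<lambda>x. h x \<in> U) (at a within A)"
proof -
  have "openin (top_of_set A) {x \<in> A. h x \<in> U}"
    using openin_continuous_map_preimage[OF assms(1,2)] by simp
  then obtain O' where "open O'" "{x \<in> A. h x \<in> U} = A \<inter> O'"
    by (auto simp: openin_open)
  then show ?thesis
    using assms(3,4) unfolding eventually_at_topological by blast
qed

section \<open>Perturbing unsatisfied players\<close>

locale analytic_game =
  fixes I :: "'i set"
    and V :: "'i \<Rightarrow> 'a::real_vector topology"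
    and S :: "'i \<Rightarrow> 'a set"
    and g :: "'i \<Rightarrow> ('i \<Rightarrow> 'a) \<Rightarrow> real"
  assumes finite_players: "finite I"
    and tvs: "\<And>i. i \<in> I \<Longrightarrow> tvs (V i)"
    and convex: "\<And>i. i \<in> I \<Longrightarrow> convex (S i)"
    and subset_tvs: "\<And>i. i \<in> I \<Longrightarrow> S i \<subseteq> topspace (V i)"
    and continuous_payoff: "\<And>i. i \<in> I \<Longrightarrow>
      continuous_map (product_topology (\<lambda>j. subtopology (V j) (S j)) I) euclideanreal (g i)"
    and analytic_payoff: "\<And>i. i \<in> I \<Longrightarrow> partially_analytic I S (g i)"
begin

abbreviation profile_topology :: "('i \<Rightarrow> 'a) topology" where
  "profile_topology \<equiv> product_topology (\<lambda>j. subtopology (V j) (S j)) I"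

lemma topspace_profile_topology: "topspace profile_topology = Pi\<^sub>E I S"
  using subset_tvs by (auto simp: PiE_iff Pi_iff)

lemma fun_upd_profile: "x \<in> Pi\<^sub>E I S \<Longrightarrow> i \<in> I \<Longrightarrow> t \<in> S i \<Longrightarrow> x(i := t) \<in> Pi\<^sub>E I S"
  by (auto simp: PiE_iff extensional_def)

text \<open>Profiles are extensional, so updating at \<open>i\<close> undoes the restriction to
  \<open>I - {i}\<close>; the \<open>ereal\<close> supremum is bounded exactly when each payoff
  is.\<close>

lemma achieves_best_response_iff:
  assumes "x \<in> Pi\<^sub>E I S" "i \<in> I"
  shows "achieves_best_response I S g x i \<longleftrightarrow> (\<forall>t\<in>S i. g i (x(i := t)) \<le> g i x)"
proof -
  have "(restrict x (I - {i}))(i := t) = x(i := t)" for t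
    using assms by (auto simp: PiE_iff extensional_def restrict_def)
  then show ?thesis
    using assms unfolding achieves_best_response_def best_response_def
    by (auto simp: SUP_le_iff)
qed

lemma not_achieves_best_responseI:
  assumes "x \<in> Pi\<^sub>E I S" "i \<in> I" "t \<in> S i" "g i x < g i (x(i := t))"
  shows "\<not> achieves_best_response I S g x i"
  using assms by (force simp: achieves_best_response_iff)

section \<open>Segments of strategies and continuity of payoffs\<close>

lemma segment_mem:
  assumes "j \<in> I" "p \<in> S j" "q \<in> S j" "a \<in> {0..1}"
  shows "a *\<^sub>R p + (1 - a) *\<^sub>R q \<in> S j"
  using convexD[OF convex[OF assms(1)] assms(2,3), of a "1 - a"] assms(4) by simp

lemma continuous_map_segment:
  assumes j: "j \<in> I" and p: "p \<in> S j" and q: "q \<in> S j"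
  shows "continuous_map (top_of_set {0..1}) (subtopology (V j) (S j)) (\<lambda>a. a *\<^sub>R p + (1 - a) *\<^sub>R q)"
proof -
  have pq: "p \<in> topspace (V j)" "q \<in> topspace (V j)" using subset_tvs j p q by auto
  have plus: "continuous_map (prod_topology (V j) (V j)) (V j) (\<lambda>(x, y). x + y)"
    and scale: "continuous_map (prod_topology euclideanreal (V j)) (V j) (\<lambda>(a, x). a *\<^sub>R x)"
    using tvs[OF j] by (auto simp: tvs_def)
  have scaled: "continuous_map (top_of_set {0..1}) (V j) (\<lambda>a. h a *\<^sub>R v)"
    if "continuous_on {0..1} h" "v \<in> topspace (V j)" for h :: "real \<Rightarrow> real" and v
    using continuous_map_compose[OF _ scale, of "top_of_set {0..1}" "\<lambda>a. (h a, v)"] that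
    by (simp add: continuous_map_pairwise o_def)
  have "continuous_map (top_of_set {0..1}) (V j) (\<lambda>a. a *\<^sub>R p + (1 - a) *\<^sub>R q)"
    using continuous_map_compose[OF _ plus, of "top_of_set {0..1}" "\<lambda>a. (a *\<^sub>R p, (1 - a) *\<^sub>R q)"]
      scaled[OF _ pq(1), of "\<lambda>a. a"] scaled[OF _ pq(2), of "\<lambda>a. 1 - a"]
    by (simp add: continuous_map_pairwise o_def continuous_intros)
  then show ?thesis
    using segment_mem[OF assms] by (auto simp: continuous_map_in_subtopology)
qed

lemma continuous_map_profile_segment:
  assumes "j \<in> I" "p \<in> S j" "q \<in> S j" "x \<in> Pi\<^sub>E I S"
  shows "continuous_map (top_of_set {0..1}) profile_topology (\<lambda>a. x(j := a *\<^sub>R p + (1 - a) *\<^sub>R q))"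
  unfolding continuous_map_componentwise
proof (intro conjI ballI)
  show "(\<lambda>a. x(j := a *\<^sub>R p + (1 - a) *\<^sub>R q)) ` topspace (top_of_set {0..1}) \<subseteq> extensional I"
    using assms by (auto simp: PiE_iff extensional_def)
  fix k assume k: "k \<in> I"
  have "x k \<in> topspace (subtopology (V k) (S k))"
    using k assms subset_tvs by (auto simp: PiE_iff)
  then show "continuous_map (top_of_set {0..1}) (subtopology (V k) (S k))
      (\<lambda>a. (x(j := a *\<^sub>R p + (1 - a) *\<^sub>R q)) k)"
    using continuous_map_segment[OF assms(1-3)] by (cases "k = j") auto
qed

lemma continuous_map_deviation_payoff:
  assumes "i \<in> I" "t \<in> S i"
  shows "continuous_map profile_topology euclideanreal (\<lambda>x. g i (x(i := t)))"
proof -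
  have "continuous_map profile_topology profile_topology (\<lambda>x. x(i := t))"
    unfolding continuous_map_componentwise
  proof (intro conjI ballI)
    show "(\<lambda>x. x(i := t)) ` topspace profile_topology \<subseteq> extensional I"
      using assms by (auto simp: PiE_iff extensional_def)
    fix k assume k: "k \<in> I"
    have "t \<in> topspace (subtopology (V i) (S i))"
      using assms subset_tvs by auto
    then show "continuous_map profile_topology (subtopology (V k) (S k)) (\<lambda>x. (x(i := t)) k)"
      using continuous_map_product_projection[OF k, of "\<lambda>j. subtopology (V j) (S j)"]
      by (cases "k = i") auto
  qed
  from continuous_map_compose[OF this continuous_payoff[OF assms(1)]] show ?thesis
    by (simp add: o_def)
qed

text \<open>For each fixed deviation \<open>t\<close>, strict improvement is an open condition by
  continuity; the set in question is the union over all \<open>t\<close>.\<close>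

lemma openin_not_achieves_best_response:
  assumes "i \<in> I"
  shows "openin profile_topology {x \<in> Pi\<^sub>E I S. \<not> achieves_best_response I S g x i}"
proof -
  have "openin profile_topology {x \<in> Pi\<^sub>E I S. g i x < g i (x(i := t))}" if "t \<in> S i" for t
  proof -
    have "continuous_map profile_topology euclideanreal (\<lambda>x. g i (x(i := t)) - g i x)"
      by (intro continuous_map_diff continuous_map_deviation_payoff continuous_payoff assms that)
    from openin_continuous_map_preimage[OF this, of "{0<..}"] show ?thesis
      by (simp only: topspace_profile_topology) simp
  qed
  then have "openin profile_topology (\<Union>t\<in>S i. {x \<in> Pi\<^sub>E I S. g i x < g i (x(i := t))})"
    by blast
  also have "(\<Union>t\<in>S i. {x \<in> Pi\<^sub>E I S. g i x < g i (x(i := t))}) =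
      {x \<in> Pi\<^sub>E I S. \<exists>t\<in>S i. g i x < g i (x(i := t))}"
    by blast
  also have "\<dots> = {x \<in> Pi\<^sub>E I S. \<not> achieves_best_response I S g x i}"
    by (intro Collect_cong conj_cong refl) (simp add: achieves_best_response_iff not_le assms)
  finally show ?thesis .
qed

section \<open>Analyticity along segments and its consequences for unsatisfied players\<close>

lemma real_analytic_on_deviation_payoff:
  assumes "i \<in> I" "t \<in> S i" "j \<in> I" "p \<in> S j" "q \<in> S j" "x \<in> Pi\<^sub>E I S"
  shows "real_analytic_on (\<lambda>a. g i (x(j := a *\<^sub>R p + (1 - a) *\<^sub>R q, i := t))) {0..1}"
proof (cases "i = j")
  case True
  then show ?thesis by (simp add: real_analytic_on_const)
next
  case False
  let ?x = "restrict (x(i := t)) (I - {j})"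
  have "?x \<in> Pi\<^sub>E (I - {j}) S"
    using assms by (auto simp: PiE_iff)
  then have "real_analytic_on (\<lambda>a. g i (?x(j := a *\<^sub>R p + (1 - a) *\<^sub>R q))) {0..1}"
    using analytic_payoff[OF assms(1)] assms unfolding partially_analytic_def by blast
  moreover have "?x(j := v) = x(j := v, i := t)" for v
    using assms False by (auto simp: PiE_iff extensional_def restrict_def)
  ultimately show ?thesis by simp
qed

lemma real_analytic_on_own_payoff:
  assumes "i \<in> I" "p \<in> S i" "q \<in> S i" "x \<in> Pi\<^sub>E I S"
  shows "real_analytic_on (\<lambda>a. g i (x(i := a *\<^sub>R p + (1 - a) *\<^sub>R q))) {0..1}"
proof -
  let ?x = "restrict x (I - {i})"
  have "?x \<in> Pi\<^sub>E (I - {i}) S"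
    using assms by (auto simp: PiE_iff)
  then have "real_analytic_on (\<lambda>a. g i (?x(i := a *\<^sub>R p + (1 - a) *\<^sub>R q))) {0..1}"
    using analytic_payoff[OF assms(1)] assms unfolding partially_analytic_def by blast
  moreover have "?x(i := v) = x(i := v)" for v
    using assms by (auto simp: PiE_iff extensional_def restrict_def)
  ultimately show ?thesis by simp
qed

text \<open>A weakening of being off the best response that does not depend on \<open>x i\<close>.
  Unlike the latter, it can be carried along large moves of the players by analyticity.\<close>

definition own_strategy_matters :: "'i \<Rightarrow> ('i \<Rightarrow> 'a) \<Rightarrow> bool" where
  "own_strategy_matters i x \<longleftrightarrow> (\<exists>t\<in>S i. \<exists>r\<in>S i. g i (x(i := t)) \<noteq> g i (x(i := r)))"

lemma own_strategy_mattersI: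
  assumes "x \<in> Pi\<^sub>E I S" "i \<in> I" "\<not> achieves_best_response I S g x i"
  shows "own_strategy_matters i x"
proof -
  obtain t where "t \<in> S i" "g i (x(i := t)) > g i x"
    using assms by (auto simp: achieves_best_response_iff not_le)
  moreover have "x i \<in> S i" using assms by auto
  ultimately show ?thesis unfolding own_strategy_matters_def
    by (metis fun_upd_triv less_irrefl)
qed

lemma openin_own_strategy_matters:
  assumes "i \<in> I"
  shows "openin profile_topology {x \<in> Pi\<^sub>E I S. own_strategy_matters i x}"
proof -
  have "openin profile_topology {x \<in> Pi\<^sub>E I S. g i (x(i := t)) \<noteq> g i (x(i := r))}"
    if "t \<in> S i" "r \<in> S i" for t r
  proof -
    have "continuous_map profile_topology euclideanreal (\<lambda>x. g i (x(i := t)) - g i (x(i := r)))"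
      by (intro continuous_map_diff continuous_map_deviation_payoff assms that)
    from openin_continuous_map_preimage[OF this, of "- {0}"] show ?thesis
      by (simp only: topspace_profile_topology) (simp add: open_Compl)
  qed
  then have "openin profile_topology
      (\<Union>t\<in>S i. \<Union>r\<in>S i. {x \<in> Pi\<^sub>E I S. g i (x(i := t)) \<noteq> g i (x(i := r))})"
    by blast
  also have "(\<Union>t\<in>S i. \<Union>r\<in>S i. {x \<in> Pi\<^sub>E I S. g i (x(i := t)) \<noteq> g i (x(i := r))}) =
      {x \<in> Pi\<^sub>E I S. own_strategy_matters i x}"
    by (auto simp: own_strategy_matters_def)
  finally show ?thesis .
qed

text \<open>Two strategies \<open>t\<close> and \<open>r\<close> that distinguish payoffs at
  \<open>b = 0\<close> are kept fixed along the segment. Their payoff difference is analytic in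
  \<open>b\<close> and nonzero at 0, so the identity theorem applies at every
  \<open>a\<close>.\<close>

lemma eventually_own_strategy_matters:
  assumes "i \<in> I" "j \<in> I" "p \<in> S j" "x \<in> Pi\<^sub>E I S" "own_strategy_matters i x" "a \<in> {0..1}"
  shows "eventually (\<lambda>b. own_strategy_matters i (x(j := b *\<^sub>R p + (1 - b) *\<^sub>R x j)))
    (at a within {0..1})"
proof -
  obtain t r where tr: "t \<in> S i" "r \<in> S i" "g i (x(i := t)) \<noteq> g i (x(i := r))"
    using assms by (auto simp: own_strategy_matters_def)
  have "x j \<in> S j" using assms by auto
  define h where "h b = g i (x(j := b *\<^sub>R p + (1 - b) *\<^sub>R x j, i := t))
    - g i (x(j := b *\<^sub>R p + (1 - b) *\<^sub>R x j, i := r))" for b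
  have "real_analytic_on h {0..1}"
    unfolding h_def using assms tr \<open>x j \<in> S j\<close>
    by (intro real_analytic_on_diff real_analytic_on_deviation_payoff) auto
  moreover have "h 0 \<noteq> 0" using tr(3) by (simp add: h_def)
  ultimately have "eventually (\<lambda>b. h b \<noteq> 0) (at a within {0..1})"
    using assms(6) by (intro real_analytic_on_eventually_nonzero[where b = 0]) auto
  then show ?thesis
    by (rule eventually_mono) (use tr in \<open>auto simp: own_strategy_matters_def h_def\<close>)
qed

text \<open>The players in \<open>K\<close> move one after the other, because analyticity is
  available only in one coordinate at a time.\<close>

lemma own_strategy_matters_dense_box:
  assumes "finite K" "K \<subseteq> I" "A \<subseteq> I" "x \<in> Pi\<^sub>E I S" "\<And>i. i \<in> A \<Longrightarrow> own_strategy_matters i x"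
    and "\<And>j. j \<in> K \<Longrightarrow> openin (subtopology (V j) (S j)) (W j)" "\<And>j. j \<in> K \<Longrightarrow> W j \<noteq> {}"
  shows "\<exists>y\<in>Pi\<^sub>E I S. (\<forall>j\<in>K. y j \<in> W j) \<and> (\<forall>j. j \<notin> K \<longrightarrow> y j = x j) \<and>
    (\<forall>i\<in>A. own_strategy_matters i y)"
  using assms
proof (induction K rule: finite_induct)
  case empty
  then show ?case by blast
next
  case (insert j K)
  then obtain y where y: "y \<in> Pi\<^sub>E I S" "\<forall>j\<in>K. y j \<in> W j" "\<forall>j. j \<notin> K \<longrightarrow> y j = x j"
    "\<forall>i\<in>A. own_strategy_matters i y"
    by auto
  have j: "j \<in> I" and W: "openin (subtopology (V j) (S j)) (W j)" using insert by auto
  obtain w where w: "w \<in> W j" using insert.prems by blast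
  have "W j \<subseteq> S j" using openin_subset[OF W] by auto
  then have "w \<in> S j" using w by blast
  have "y j \<in> S j" using y(1) j by auto
  define z where "z b = b *\<^sub>R w + (1 - b) *\<^sub>R y j" for b :: real
  have "finite A" using insert.prems finite_players finite_subset by blast
  \<comment> \<open>At \<open>b = 1\<close>, where \<open>j\<close> plays \<open>w\<close> itself,
    the property may fail. The punctured filter avoids this point, and openness of
    \<open>W j\<close> leaves room to stop just before it.\<close>
  then have "eventually (\<lambda>b. \<forall>i\<in>A. own_strategy_matters i (y(j := z b))) (at 1 within {0..1})"
    unfolding z_def using insert.prems y j \<open>w \<in> S j\<close>
    by (intro eventually_ball_finite ballI eventually_own_strategy_matters) auto
  moreover have "eventually (\<lambda>b. z b \<in> W j) (at 1 within {0..1})"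
    unfolding z_def
    by (rule continuous_map_eventually_at[OF continuous_map_segment[OF j \<open>w \<in> S j\<close> \<open>y j \<in> S j\<close>] W])
      (use w in auto)
  ultimately have "eventually (\<lambda>b. (\<forall>i\<in>A. own_strategy_matters i (y(j := z b))) \<and> z b \<in> W j)
      (at 1 within {0..1})"
    by (rule eventually_conj)
  then obtain b where b: "\<forall>i\<in>A. own_strategy_matters i (y(j := z b))" "z b \<in> W j"
    using eventually_happens'[OF at_within_unit_interval_neq_bot[of 1]] by auto
  then show ?case
    using y j \<open>W j \<subseteq> S j\<close> insert.hyps
    by (intro bexI[of _ "y(j := z b)"] conjI fun_upd_profile b(1)) auto
qed

lemma own_strategy_matters_dense:
  assumes J: "J \<subseteq> I" and A: "A \<subseteq> I" and x: "x \<in> Pi\<^sub>E I S"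
    and matters: "\<And>i. i \<in> A \<Longrightarrow> own_strategy_matters i x"
    and N: "openin profile_topology N" "y \<in> N" and eq: "\<And>k. k \<notin> J \<Longrightarrow> y k = x k"
  obtains z where "z \<in> N" "\<And>k. k \<notin> J \<Longrightarrow> z k = x k" "\<And>i. i \<in> A \<Longrightarrow> own_strategy_matters i z"
proof -
  obtain W where W: "\<And>j. j \<in> I \<Longrightarrow> openin (subtopology (V j) (S j)) (W j)" "y \<in> Pi\<^sub>E I W" "Pi\<^sub>E I W \<subseteq> N"
    using N unfolding openin_product_topology_alt by (metis (no_types, lifting))
  have "\<exists>z\<in>Pi\<^sub>E I S. (\<forall>j\<in>J. z j \<in> W j) \<and> (\<forall>j. j \<notin> J \<longrightarrow> z j = x j) \<and>
      (\<forall>i\<in>A. own_strategy_matters i z)"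
    by (rule own_strategy_matters_dense_box)
      (use J A x matters W(1,2) finite_subset[OF J finite_players] in blast)+
  then obtain z where z: "z \<in> Pi\<^sub>E I S" "\<forall>j\<in>J. z j \<in> W j" "\<forall>j. j \<notin> J \<longrightarrow> z j = x j"
      "\<forall>i\<in>A. own_strategy_matters i z"
    by blast
  \<comment> \<open>Coordinates outside \<open>J\<close> have not moved and agree with those of
    \<open>y\<close>, which lies in the box.\<close>
  have "z k \<in> W k" if "k \<in> I" for k
    using z(2,3) eq[of k] PiE_mem[OF W(2) that] by (cases "k \<in> J") auto
  then have "z \<in> Pi\<^sub>E I W" using z(1) by (simp add: PiE_iff)
  then have "z \<in> N" using W(3) by blast
  then show thesis using z that by blast
qed

text \<open>The players of \<open>B\<close> are treated one by one. A player at a best response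
  leaves it by a small change of the own strategy, small enough to keep the open conditions already
  secured.\<close>

lemma not_achieves_best_response_dense_aux:
  assumes "finite B" "B \<subseteq> A" "A \<subseteq> I" "openin profile_topology N" "x \<in> N"
    and "\<And>i. i \<in> A \<Longrightarrow> own_strategy_matters i x"
  shows "\<exists>z\<in>N. (\<forall>k. k \<notin> A \<longrightarrow> z k = x k) \<and> (\<forall>i\<in>A. own_strategy_matters i z) \<and>
    (\<forall>i\<in>B. \<not> achieves_best_response I S g z i)"
  using assms(1,2)
proof (induction B rule: finite_induct)
  case empty
  then show ?case using assms by blast
next
  case (insert i B)
  then obtain z where z: "z \<in> N" "\<forall>k. k \<notin> A \<longrightarrow> z k = x k" "\<forall>i\<in>A. own_strategy_matters i z"
    "\<forall>i\<in>B. \<not> achieves_best_response I S g z i"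
    by auto
  have zS: "z \<in> Pi\<^sub>E I S"
    using z(1) openin_subset[OF assms(4)] by (simp only: topspace_profile_topology) blast
  have i: "i \<in> I" "i \<in> A" using insert assms by auto
  show ?case
  proof (cases "achieves_best_response I S g z i")
    case False
    then show ?thesis using z by blast
  next
    case True
    have zi: "z i \<in> S i" using zS i by auto
    \<comment> \<open>Two distinct payoff values cannot both equal \<open>g i z\<close>.\<close>
    obtain t where t: "t \<in> S i" "g i (z(i := t)) \<noteq> g i z"
      using z(3) i(2) unfolding own_strategy_matters_def by metis
    define h where "h b = z(i := b *\<^sub>R t + (1 - b) *\<^sub>R z i)" for b :: real
    have h0: "h 0 = z" by (simp add: h_def)
    have hS: "h b \<in> Pi\<^sub>E I S" if "b \<in> {0..1}" for b
      unfolding h_def using segment_mem[OF i(1) t(1) zi that] by (intro fun_upd_profile zS i)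
    \<comment> \<open>The conditions that the move of \<open>i\<close> must preserve; a finite
      intersection of open sets.\<close>
    define M where "M = N \<inter> (\<Inter>k\<in>B. {x \<in> Pi\<^sub>E I S. \<not> achieves_best_response I S g x k}) \<inter>
      (\<Inter>k\<in>A. {x \<in> Pi\<^sub>E I S. own_strategy_matters k x})"
    have BA: "finite A" "finite B" "B \<subseteq> I" using insert assms finite_subset finite_players by blast+
    have "openin profile_topology (N \<inter> \<Inter>((\<lambda>k. {x \<in> Pi\<^sub>E I S. \<not> achieves_best_response I S g x k}) ` B \<union>
        (\<lambda>k. {x \<in> Pi\<^sub>E I S. own_strategy_matters k x}) ` A))"
    proof (intro openin_Int_Inter)
      fix X assume "X \<in> (\<lambda>k. {x \<in> Pi\<^sub>E I S. \<not> achieves_best_response I S g x k}) ` B \<union>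
        (\<lambda>k. {x \<in> Pi\<^sub>E I S. own_strategy_matters k x}) ` A"
      then show "openin profile_topology X"
        using BA assms(3) openin_not_achieves_best_response openin_own_strategy_matters by blast
    qed (use BA assms in auto)
    then have "openin profile_topology M" by (simp add: M_def Inter_Un_distrib Int_assoc)
    moreover have "h 0 \<in> M" using z zS h0 by (simp add: M_def)
    moreover have "continuous_map (top_of_set {0..1}) profile_topology h"
      unfolding h_def by (intro continuous_map_profile_segment i t zi zS)
    ultimately have "eventually (\<lambda>b. h b \<in> M) (at 0 within {0..1})"
      by (intro continuous_map_eventually_at) auto
    moreover have "eventually (\<lambda>b. g i (h b) - g i z \<noteq> 0) (at 0 within {0..1})"
    proof (rule real_analytic_on_eventually_nonzero[where b = 1])
      show "real_analytic_on (\<lambda>b. g i (h b) - g i z) {0..1}"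
        unfolding h_def
        by (intro real_analytic_on_diff real_analytic_on_own_payoff real_analytic_on_const i t zi zS)
    qed (use t in \<open>auto simp: h_def\<close>)
    moreover have "eventually (\<lambda>b. b \<in> {0..1}) (at 0 within {0..1::real})"
      by (simp add: eventually_at_filter)
    ultimately have "eventually (\<lambda>b. h b \<in> M \<and> g i (h b) - g i z \<noteq> 0 \<and> b \<in> {0..1}) (at 0 within {0..1})"
      by (intro eventually_conj)
    then obtain b where b: "h b \<in> M" "g i (h b) \<noteq> g i z" "b \<in> {0..1}"
      using eventually_happens'[OF at_within_unit_interval_neq_bot[of 0]] by auto
    \<comment> \<open>Since \<open>z i\<close> is a best response, the changed payoff can only be
      lower. Returning to \<open>z i\<close> is then a profitable deviation from
      \<open>h b\<close>.\<close>
    have "g i (h b) \<le> g i z"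
      using True segment_mem[OF i(1) t(1) zi b(3)] zS i by (simp add: achieves_best_response_iff h_def)
    then have "g i (h b) < g i ((h b)(i := z i))" using b(2) by (simp add: h_def)
    then have "\<not> achieves_best_response I S g (h b) i"
      using not_achieves_best_responseI hS b(3) i(1) zi by blast
    moreover have "h b k = x k" if "k \<notin> A" for k
      using that z(2) i(2) by (auto simp: h_def)
    moreover have "h b \<in> N" "\<forall>k\<in>A. own_strategy_matters k (h b)"
      "\<forall>k\<in>B. \<not> achieves_best_response I S g (h b) k"
      using b(1) by (auto simp: M_def)
    ultimately show ?thesis by (intro bexI[of _ "h b"]) simp_all
  qed
qed

text \<open>Two stages: a large move of the players in \<open>J\<close> into \<open>N\<close> keeps
  payoffs of \<open>A\<close> non-constant, then a correction inside \<open>N\<close> by the players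
  in \<open>A\<close> alone makes them unsatisfied again.\<close>

lemma not_achieves_best_response_dense:
  assumes "A \<subseteq> J" "J \<subseteq> I" "x \<in> Pi\<^sub>E I S" "\<And>i. i \<in> A \<Longrightarrow> \<not> achieves_best_response I S g x i"
    and "openin profile_topology N" "y \<in> N" "\<And>k. k \<notin> J \<Longrightarrow> y k = x k"
  obtains z where "z \<in> N" "\<And>k. k \<notin> J \<Longrightarrow> z k = x k"
    "\<And>i. i \<in> A \<Longrightarrow> \<not> achieves_best_response I S g z i"
proof -
  have AI: "A \<subseteq> I" using assms by blast
  have "own_strategy_matters i x" if "i \<in> A" for i
    using that assms AI by (intro own_strategy_mattersI) auto
  then obtain v where v: "v \<in> N" "\<And>k. k \<notin> J \<Longrightarrow> v k = x k" "\<And>i. i \<in> A \<Longrightarrow> own_strategy_matters i v"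
    using own_strategy_matters_dense[OF assms(2) AI assms(3) _ assms(5-7)] by blast
  show thesis
    using not_achieves_best_response_dense_aux[OF finite_subset[OF AI finite_players] subset_refl AI
        assms(5) v(1,3)] v(2) assms(1) that by (metis subsetD)
qed

section \<open>Paths to equilibrium\<close>

text \<open>For a player in \<open>J\<close>, deviating within \<open>w\<close> and then filling in
  \<open>s\<close> gives the same profile as filling in first and deviating afterwards.\<close>

lemma subgame_equilibrium_achieves_best_response:
  assumes J: "J \<subseteq> I" and s: "s \<in> Pi\<^sub>E I S" and i: "i \<in> J"
    and w: "equilibrium J S (subgame_payoff J g s) w"
  shows "override_on s w J \<in> Pi\<^sub>E I S" "achieves_best_response I S g (override_on s w J) i"
proof -
  have wS: "w \<in> Pi\<^sub>E J S" using w by (simp add: equilibrium_def)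
  show "override_on s w J \<in> Pi\<^sub>E I S"
    using J s wS by (auto simp: PiE_iff override_on_def extensional_def)
  have "override_on s ((restrict w (J - {i}))(i := r)) J =
      (restrict (override_on s w J) (I - {i}))(i := r)" for r
    using J s i by (auto simp: fun_eq_iff override_on_def PiE_iff extensional_def)
  then show "achieves_best_response I S g (override_on s w J) i"
    using w i unfolding equilibrium_def achieves_best_response_def best_response_def subgame_payoff_def
    by (auto simp: override_on_def)
qed

definition unsatisfied :: "'i set set \<Rightarrow> ('i \<Rightarrow> 'a) \<Rightarrow> 'i set set" where
  "unsatisfied P s = {p \<in> P. \<not> group_achieves_best_response I S g s p}"

text \<open>By disjointness, no player of a satisfied group belongs to an unsatisfied one, so the
  prepended step keeps all satisfied groups in place.\<close>

lemma grouped_satisficing_path_Suc: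
  assumes "group_set I P" "s \<in> Pi\<^sub>E I S" "grouped_satisficing_path I S g P \<sigma> T"
    and eq: "\<And>k. k \<notin> \<Union>(unsatisfied P s) \<Longrightarrow> \<sigma> 0 k = s k"
  shows "grouped_satisficing_path I S g P (case_nat s \<sigma>) (Suc T)"
proof -
  have "\<sigma> 0 i = s i" if "p \<in> P" "group_achieves_best_response I S g s p" "i \<in> p" for p i
  proof (rule eq)
    have "disjoint P" using assms(1) by (simp add: group_set_def)
    then have "q = p" if "q \<in> P" "i \<in> q" for q
      using disjointD[of P p q] \<open>p \<in> P\<close> \<open>i \<in> p\<close> that by blast
    then show "i \<notin> \<Union>(unsatisfied P s)"
      using that(2) unfolding unsatisfied_def by blast
  qed
  then show ?thesis
    using assms(2,3) unfolding grouped_satisficing_path_def by (auto split: nat.split simp: less_Suc_eq_0_disj)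
qed

text \<open>Induction on the number of satisfied groups, which drops whenever the set of unsatisfied
  groups can be enlarged.\<close>

lemma exists_path_to_equilibrium:
  assumes P: "group_set I P" and sub: "any_subgame_has_equilibrium I S g P" and "s \<in> Pi\<^sub>E I S"
  shows "\<exists>\<sigma> T. grouped_satisficing_path I S g P \<sigma> T \<and> \<sigma> 0 = s \<and> equilibrium I S g (\<sigma> T)"
  using \<open>s \<in> Pi\<^sub>E I S\<close>
proof (induction "card (P - unsatisfied P s)" arbitrary: s rule: less_induct)
  case (less s)
  let ?J = "\<Union>(unsatisfied P s)"
  have "\<Union>P = I" using P by (simp add: group_set_def)
  then have J: "?J \<subseteq> I" by (auto simp: unsatisfied_def)
  have "finite P" using \<open>\<Union>P = I\<close> finite_players finite_UnionD by blast
  have extend: "\<exists>\<sigma> T. grouped_satisficing_path I S g P \<sigma> T \<and> \<sigma> 0 = s \<and> equilibrium I S g (\<sigma> T)"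
    if "grouped_satisficing_path I S g P \<sigma> T" "equilibrium I S g (\<sigma> T)"
      "\<And>k. k \<notin> ?J \<Longrightarrow> \<sigma> 0 k = s k" for \<sigma> T
    using grouped_satisficing_path_Suc[OF P less.prems that(1,3)] that(2)
    by (intro exI[of _ "case_nat s \<sigma>"] exI[of _ "Suc T"]) simp
  show ?case
  proof (cases "\<exists>x\<in>Pi\<^sub>E I S. (\<forall>k. k \<notin> ?J \<longrightarrow> x k = s k) \<and> unsatisfied P s \<subset> unsatisfied P x")
    case True
    then obtain x where x: "x \<in> Pi\<^sub>E I S" "\<And>k. k \<notin> ?J \<Longrightarrow> x k = s k" "unsatisfied P s \<subset> unsatisfied P x"
      by blast
    have "P - unsatisfied P x \<subset> P - unsatisfied P s"
      using x(3) by (auto simp: unsatisfied_def)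
    then have "card (P - unsatisfied P x) < card (P - unsatisfied P s)"
      using \<open>finite P\<close> by (intro psubset_card_mono) auto
    from less.hyps[OF this x(1)] show ?thesis using extend x(2) by metis
  next
    case False
    have "unsatisfied P s \<subseteq> P" by (auto simp: unsatisfied_def)
    then obtain w where w: "equilibrium ?J S (subgame_payoff ?J g s) w"
      using sub less.prems unfolding any_subgame_has_equilibrium_def by blast
    define y where "y = override_on s w ?J"
    have yJ: "achieves_best_response I S g y i" if "i \<in> ?J" for i
      unfolding y_def by (rule subgame_equilibrium_achieves_best_response[OF J less.prems that w])
    have yS: "y \<in> Pi\<^sub>E I S"
    \<comment> \<open>The sub-game lemma needs a player of \<open>?J\<close>; without one,
      \<open>y\<close> is \<open>s\<close>.\<close>
    proof (cases "?J = {}")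
      case True
      then show ?thesis unfolding y_def using less.prems by (simp only: True override_on_emptyset)
    next
      case False
      then show ?thesis
        unfolding y_def using subgame_equilibrium_achieves_best_response(1)[OF J less.prems _ w] by blast
    qed
    have yeq: "y k = s k" if "k \<notin> ?J" for k using that by (simp add: y_def)
    have "achieves_best_response I S g y i" if i: "i \<in> I" for i
    proof (rule ccontr)
      assume unsat: "\<not> achieves_best_response I S g y i"
      then have "i \<notin> ?J" using yJ by blast
      obtain p where p: "p \<in> P" "i \<in> p" using i \<open>\<Union>P = I\<close> by blast
      define N where "N = {x \<in> Pi\<^sub>E I S. \<not> achieves_best_response I S g x i}"
      \<comment> \<open>Only the players unsatisfied in \<open>s\<close>, not all of
        \<open>?J\<close>, are known to have a non-constant own payoff. Every unsatisfied group
        contains one of them, which suffices to keep it unsatisfied.\<close>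
      define A where "A = {k \<in> ?J. \<not> achieves_best_response I S g s k}"
      obtain z where z: "z \<in> N" "\<And>k. k \<notin> ?J \<Longrightarrow> z k = s k"
        "\<And>k. k \<in> A \<Longrightarrow> \<not> achieves_best_response I S g z k"
      proof (rule not_achieves_best_response_dense[of A ?J s N y])
        show "openin profile_topology N"
          unfolding N_def by (rule openin_not_achieves_best_response[OF i])
      qed (use J less.prems unsat yS yeq in \<open>auto simp: A_def N_def\<close>)
      have "unsatisfied P s \<subseteq> unsatisfied P z"
      proof
        fix q assume q: "q \<in> unsatisfied P s"
        then obtain k where "k \<in> q" "\<not> achieves_best_response I S g s k"
          by (auto simp: unsatisfied_def group_achieves_best_response_def)
        then have "k \<in> A" using q by (auto simp: A_def)
        then show "q \<in> unsatisfied P z"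
          using z(3) q \<open>k \<in> q\<close> by (auto simp: unsatisfied_def group_achieves_best_response_def)
      qed
      moreover have "p \<in> unsatisfied P z"
        using z(1) p by (auto simp: N_def unsatisfied_def group_achieves_best_response_def)
      moreover have "p \<notin> unsatisfied P s" using \<open>i \<notin> ?J\<close> p by blast
      moreover have "z \<in> Pi\<^sub>E I S" using z(1) by (simp add: N_def)
      ultimately show False using False z(2) by blast
    qed
    then have "equilibrium I S g y" using yS by (simp add: equilibrium_def)
    \<comment> \<open>The path of length 0 at \<open>y\<close>, with \<open>s\<close> prepended: a
      single step reaches the equilibrium.\<close>
    then show ?thesis
      using extend[of "\<lambda>_. y" 0] yS yeq by (simp add: grouped_satisficing_path_def)
  qed
qed

end

theorem theorem2:
  fixes I :: "'i set"
    and V :: "'i \<Rightarrow> 'a::real_vector topology"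
    and S :: "'i \<Rightarrow> 'a set"
    and g :: "'i \<Rightarrow> ('i \<Rightarrow> 'a) \<Rightarrow> real"
    and P :: "'i set set"
    and s :: "'i \<Rightarrow> 'a"
  assumes "finite I"
    and "group_set I P"
    and "\<And>i. i \<in> I \<Longrightarrow> tvs (V i)"
    and "\<And>i. i \<in> I \<Longrightarrow> convex (S i)"
    and "\<And>i. i \<in> I \<Longrightarrow> compactin (V i) (S i)"
    and "\<And>i. i \<in> I \<Longrightarrow>
           continuous_map (product_topology (\<lambda>j. subtopology (V j) (S j)) I) euclideanreal (g i)"
    and "\<And>i. i \<in> I \<Longrightarrow> partially_analytic I S (g i)"
    and "any_subgame_has_equilibrium I S g P"
    and "s \<in> Pi\<^sub>E I S"
  shows "\<exists>\<sigma> T. grouped_satisficing_path I S g P \<sigma> T \<and> \<sigma> 0 = s \<and> equilibrium I S g (\<sigma> T)"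
proof -
  interpret analytic_game I V S g
    by (intro analytic_game.intro compactin_subset_topspace assms(1,3-7))
  show ?thesis
    by (rule exists_path_to_equilibrium[OF assms(2,8,9)])
qed

end
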